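(* Let $G=(V,E)$ be a finite simple graph with node weights $w\in\mathbb{R}^V_+$ and edge weights satisfying $w_{ij}\ge\min\{w_i,w_j\}$ for all edges $ij\in E$. For any integer $t\ge 2$, $$\rho_t(G,w)-p_{G,w}\in H_t\quad\text{and}\quad p_{\mathrm{han}}^{(t)}(G,w)\le\rho_t(G,w).$$
   Context: Let $V=[n]$. For $I\subseteq V$ write $x^I=\prod_{i\in I}x_i$ and $(1-x)^I=\prod_{i\in I}(1-x_i)$. For an integer $t\ge 1$, $$H_t=\Big\{\sum_{T\subseteq V,\ |T|\le t}\ \sum_{I\subseteq T}c_{T,I}\,x^I(1-x)^{T\setminus I}:\ c_{T,I}\ge 0\Big\}\subseteq\mathbb{R}[x_1,\dots,x_n].$$ Set $p_{G,w}=\sum_{i\in V}w_ix_i-\sum_{ij\in E}w_{ij}x_ix_j$ and $p_{\mathrm{han}}^{(t)}(G,w)=\inf\{\lambda\in\mathbb{R}:\lambda-p_{G,w}\in H_t\}$. For an integer $t\ge1$, the fractional $t$-clique cover number is $$\rho_t(G,w)=\min\Big\{\sum_C\lambda_C:\ \sum_C\lambda_C\chi^C=w,\ \lambda_C\ge 0\Big\},$$ where $C$ ranges over the cliques of $G$ (sets of pairwise adjacent nodes, including single nodes) with $|C|\le t$ and $\chi^C\in\{0,1\}^V$ is the characteristic vector of $C$. *)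

theory Defs
  imports "HOL-Library.Poly_Mapping" "HOL-Library.Extended_Real" "HOL-Library.Indicator_Function"
begin

text \<open>Polynomials are finitely supported maps from monomials (exponent vectors) to coefficients,
  with the convolution product of \<^theory>\<open>HOL-Library.Poly_Mapping\<close>. The variables are indexed by
  all natural numbers; everything below only involves the variables indexed by \<open>{1..n}\<close>.\<close>

type_synonym real_mpoly = "(nat \<Rightarrow>\<^sub>0 nat) \<Rightarrow>\<^sub>0 real"

definition pconst :: "real \<Rightarrow> real_mpoly" where
  "pconst c = Poly_Mapping.single 0 c"

definition pvar :: "nat \<Rightarrow> real_mpoly" where
  "pvar i = Poly_Mapping.single (Poly_Mapping.single i 1) 1"

text \<open>A graph on \<open>{1..n}\<close> is given by its set of edges, each a two-element set of nodes; edge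
  weights are functions on such sets, hence symmetric.\<close>

definition simple_graph :: "nat \<Rightarrow> nat set set \<Rightarrow> bool" where
  "simple_graph n E \<longleftrightarrow> (\<forall>e\<in>E. e \<subseteq> {1..n} \<and> card e = 2)"

definition handelman_cone :: "nat \<Rightarrow> nat \<Rightarrow> real_mpoly set" where
  "handelman_cone t n =
     {\<Sum>T | T \<subseteq> {1..n} \<and> card T \<le> t.
        \<Sum>I\<in>Pow T. pconst (c T I) * ((\<Prod>i\<in>I. pvar i) * (\<Prod>i\<in>T - I. 1 - pvar i))
      | c. \<forall>T I. T \<subseteq> {1..n} \<and> card T \<le> t \<and> I \<subseteq> T \<longrightarrow> 0 \<le> c T I}"

text \<open>For an edge \<open>e = {i, j}\<close> the product over \<open>e\<close> is the monomial \<open>x\<^sub>i x\<^sub>j\<close>.\<close>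

definition graph_poly ::
    "nat \<Rightarrow> nat set set \<Rightarrow> (nat \<Rightarrow> real) \<Rightarrow> (nat set \<Rightarrow> real) \<Rightarrow> real_mpoly" where
  "graph_poly n E w u =
     (\<Sum>i\<in>{1..n}. pconst (w i) * pvar i) - (\<Sum>e\<in>E. pconst (u e) * (\<Prod>i\<in>e. pvar i))"

text \<open>The infimum is taken in the extended reals, so that it is \<open>\<infinity>\<close> for an empty set.\<close>

definition handelman_bound ::
    "nat \<Rightarrow> nat \<Rightarrow> nat set set \<Rightarrow> (nat \<Rightarrow> real) \<Rightarrow> (nat set \<Rightarrow> real) \<Rightarrow> ereal" where
  "handelman_bound t n E w u =
     (INF r\<in>{r :: real. pconst r - graph_poly n E w u \<in> handelman_cone t n}. ereal r)"

text \<open>The empty set counts as a clique; it contributes nothing to the covering constraint, so this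
  does not affect the minimum below.\<close>

definition cliques :: "nat \<Rightarrow> nat \<Rightarrow> nat set set \<Rightarrow> nat set set" where
  "cliques t n E =
     {C. C \<subseteq> {1..n} \<and> card C \<le> t \<and> (\<forall>i\<in>C. \<forall>j\<in>C. i \<noteq> j \<longrightarrow> {i, j} \<in> E)}"

definition fractional_clique_covers ::
    "nat \<Rightarrow> nat \<Rightarrow> nat set set \<Rightarrow> (nat \<Rightarrow> real) \<Rightarrow> (nat set \<Rightarrow> real) set" where
  "fractional_clique_covers t n E w =
     {l. (\<forall>C\<in>cliques t n E. 0 \<le> l C) \<and>
         (\<forall>i\<in>{1..n}. (\<Sum>C\<in>cliques t n E. l C * indicator C i) = w i)}"

text \<open>The least element of a set of reals, i.e. its minimum (not merely its infimum).\<close>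

definition fractional_clique_cover_number ::
    "nat \<Rightarrow> nat \<Rightarrow> nat set set \<Rightarrow> (nat \<Rightarrow> real) \<Rightarrow> real" where
  "fractional_clique_cover_number t n E w =
     (LEAST r. r \<in> (\<lambda>l. \<Sum>C\<in>cliques t n E. l C) ` fractional_clique_covers t n E w)"

end

theory Submission imports Defs "HOL-Analysis.Function_Topology" begin

text \<open>A fractional clique cover \<open>l\<close> splits \<open>\<Sum>C. l C - p\<close> into
  \<open>\<Sum>C. l C * (1 - \<Sum>i\<in>C. x\<^sub>i + \<Sum>e\<subseteq>C. x\<^sup>e)\<close> and \<open>\<Sum>e. (u e - \<Sum>C\<supseteq>e. l C) * x\<^sup>e\<close>. The coefficients in
  the second part are nonnegative, since the cliques containing an edge \<open>ij\<close> have total weight at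
  most \<open>min (w i) (w j)\<close>. The polynomial multiplying \<open>l C\<close> is multilinear with value
  \<open>(k - 1) * (k - 2) / 2 \<ge> 0\<close> at a 0/1 point having \<open>k\<close> ones in \<open>C\<close>, so it is a nonnegative
  combination of the products \<open>x\<^sup>I(1 - x)\<^bsup>C - I\<^esup>\<close>. Finally, the minimum defining the cover number is
  attained by compactness.\<close>

section \<open>Attainment of the minimum of a linear program\<close>

text \<open>\<open>S\<close> leaves the coordinates outside \<open>A\<close> free, so it need not be
  compact. Truncating them to 0 with \<open>r\<close> changes neither membership in \<open>S\<close>
  nor the objective, and then a compact box \<open>P\<close> is enough to search.\<close>

lemma nonneg_sum_attains_min:
  fixes m :: "'a \<Rightarrow> 'i \<Rightarrow> real" and b :: "'i \<Rightarrow> real"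
  assumes "finite A"
    and S_def: "S = {l. (\<forall>a\<in>A. 0 \<le> l a) \<and> (\<forall>i\<in>J. (\<Sum>a\<in>A. l a * m a i) = b i)}"
    and "S \<noteq> {}"
  obtains l where "l \<in> S" and "\<And>l'. l' \<in> S \<Longrightarrow> sum l A \<le> sum l' A"
proof -
  obtain l0 where l0: "l0 \<in> S" using assms(3) by blast
  define r where "r l = (\<lambda>a. if a \<in> A then l a else 0)" for l :: "'a \<Rightarrow> real"
  have r_S: "r l \<in> S" if "l \<in> S" for l
    using that by (simp add: S_def r_def cong: sum.cong)
  have r_sum: "sum (r l) A = sum l A" for l
    by (simp add: r_def cong: sum.cong)
  \<comment> \<open>By nonnegativity, no coordinate in \<open>A\<close> of a point at least as good
    as \<open>l0\<close> exceeds \<open>sum l0 A\<close>. All other factors are the single point 0,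
    and Tychonoff makes the product compact.\<close>
  define P where "P = Pi\<^sub>E UNIV (\<lambda>a. if a \<in> A then {0..sum l0 A} else {0::real})"
  have r_P: "r l \<in> P" if "l \<in> S" "sum l A \<le> sum l0 A" for l
  proof -
    have "l a \<le> sum l0 A" if "a \<in> A" for a
      using member_le_sum[of a A l] that \<open>l \<in> S\<close> \<open>sum l A \<le> sum l0 A\<close> \<open>finite A\<close>
      by (fastforce simp: S_def)
    then show ?thesis using that(1) by (auto simp: P_def r_def S_def)
  qed
  have "compactin (product_topology (\<lambda>_. euclidean) UNIV) P"
    unfolding P_def compactin_PiE by auto
  then have "compact P"
    by (simp add: euclidean_product_topology)
  have cont: "continuous_on UNIV (\<lambda>l :: 'a \<Rightarrow> real. l a)" for a
    by (rule continuous_on_product_coordinates)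
  have "S = (\<Inter>a\<in>A. {l. 0 \<le> l a}) \<inter> (\<Inter>i\<in>J. {l. (\<Sum>a\<in>A. l a * m a i) = b i})"
    by (auto simp: S_def)
  moreover have "closed {l :: 'a \<Rightarrow> real. 0 \<le> l a}" for a
    by (intro closed_Collect_le continuous_intros cont)
  moreover have "closed {l :: 'a \<Rightarrow> real. (\<Sum>a\<in>A. l a * m a i) = b i}" for i
    by (intro closed_Collect_eq continuous_intros cont)
  ultimately have "closed S"
    by (simp add: closed_Int closed_INT)
  then have "compact (P \<inter> S)"
    using \<open>compact P\<close> by (rule compact_Int_closed[rotated])
  moreover have "P \<inter> S \<noteq> {}"
    using r_P r_S l0 by fastforce
  moreover have "continuous_on (P \<inter> S) (\<lambda>l. sum l A)"
    by (intro continuous_intros continuous_on_subset[OF cont]) auto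
  ultimately obtain l where l: "l \<in> P \<inter> S" "\<And>l'. l' \<in> P \<inter> S \<Longrightarrow> sum l A \<le> sum l' A"
    using continuous_attains_inf[of "P \<inter> S" "\<lambda>l. sum l A"] by blast
  show ?thesis
  proof
    show "l \<in> S" using l by blast
    fix l' assume "l' \<in> S"
    \<comment> \<open>This settles any \<open>l'\<close> worse than \<open>l0\<close>, whose
      truncation may lie outside \<open>P\<close>; every other \<open>l'\<close> is compared through
      \<open>r l'\<close>.\<close>
    have "sum l A \<le> sum (r l0) A" using l(2) r_P r_S l0 by blast
    then show "sum l A \<le> sum l' A"
      using l(2)[of "r l'"] r_P[of l'] r_S[of l'] \<open>l' \<in> S\<close> by (fastforce simp: r_sum)
  qed
qed

section \<open>Elementary symmetric polynomials\<close>

text \<open>A pair in \<open>insert v C\<close> either avoids \<open>v\<close> or is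
  \<open>{v, i}\<close> for exactly one \<open>i\<close> in \<open>C\<close>.\<close>

lemma sum_pairs_insert:
  fixes x :: "'i \<Rightarrow> 'a::comm_ring_1"
  assumes "finite C" "v \<notin> C"
  shows "(\<Sum>e | e \<subseteq> insert v C \<and> card e = 2. \<Prod>i\<in>e. x i)
    = (\<Sum>e | e \<subseteq> C \<and> card e = 2. \<Prod>i\<in>e. x i) + x v * (\<Sum>i\<in>C. x i)"
proof -
  have "{e. e \<subseteq> insert v C \<and> card e = 2}
      = {e. e \<subseteq> C \<and> card e = 2} \<union> (\<lambda>i. {v, i}) ` C" (is "?L = ?R")
  proof
    show "?L \<subseteq> ?R"
      by (fastforce simp: card_2_iff doubleton_eq_iff)
    show "?R \<subseteq> ?L" using assms by (auto simp: card_2_iff)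
  qed
  moreover have "(\<Sum>e\<in>(\<lambda>i. {v, i}) ` C. \<Prod>i\<in>e. x i) = (\<Sum>i\<in>C. \<Prod>j\<in>{v, i}. x j)"
    using assms by (intro sum.reindex_cong[of "\<lambda>i. {v, i}"]) (auto simp: inj_on_def doubleton_eq_iff)
  moreover have "(\<Prod>j\<in>{v, i}. x j) = x v * x i" if "i \<in> C" for i
  proof -
    have "v \<noteq> i" using assms that by blast
    then show ?thesis by simp
  qed
  moreover have "{e. e \<subseteq> C \<and> card e = 2} \<inter> (\<lambda>i. {v, i}) ` C = {}"
    using assms by auto
  ultimately show ?thesis
    using assms by (simp add: sum.union_disjoint sum_distrib_left)
qed

text \<open>The factor \<open>q\<close> collects the factors \<open>x v\<close> and \<open>1 - x v\<close> of the nodes already removed from \<open>C\<close>.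
  The step rests on \<open>g(C \<union> {v}) = (1 - x\<^sub>v) * g(C) + x\<^sub>v * e\<^sub>2(C)\<close>, with \<open>g = 1 - e\<^sub>1 + e\<^sub>2\<close>; a direct
  induction on \<open>g\<close> alone does not go through.\<close>

lemma elementary_symmetric_in_cone:
  fixes x :: "'i \<Rightarrow> 'a::comm_ring_1"
  assumes "finite C" and "0 \<in> K" and add: "\<And>p q. p \<in> K \<Longrightarrow> q \<in> K \<Longrightarrow> p + q \<in> K"
    and "\<And>I. I \<subseteq> C \<Longrightarrow> q * ((\<Prod>i\<in>I. x i) * (\<Prod>i\<in>C - I. 1 - x i)) \<in> K"
  defines "e2 \<equiv> \<lambda>C. \<Sum>e | e \<subseteq> C \<and> card e = 2. \<Prod>i\<in>e. x i"
  shows "q \<in> K \<and> q * (\<Sum>i\<in>C. x i) \<in> K \<and> q * e2 C \<in> K \<and> q * (1 - (\<Sum>i\<in>C. x i) + e2 C) \<in> K"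
  using assms(1,4)
proof (induction C arbitrary: q rule: finite_induct)
  case empty
  have "{e :: 'i set. e \<subseteq> {} \<and> card e = 2} = {}" by auto
  then have "e2 {} = 0" unfolding e2_def by (simp only: sum.empty)
  then show ?case using empty[of "{}"] \<open>0 \<in> K\<close> by simp
next
  case (insert v C)
  \<comment> \<open>Both multipliers turn the generators on \<open>C\<close> into generators on
    \<open>insert v C\<close>: \<open>?a\<close> keeps \<open>I\<close>, while \<open>?b\<close>
    replaces it by \<open>insert v I\<close>.\<close>
  let ?a = "q * (1 - x v)" and ?b = "q * x v"
  have a: "?a \<in> K \<and> ?a * (\<Sum>i\<in>C. x i) \<in> K \<and> ?a * e2 C \<in> K \<and> ?a * (1 - (\<Sum>i\<in>C. x i) + e2 C) \<in> K"
  proof (rule insert.IH)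
    fix I assume "I \<subseteq> C"
    then have "v \<notin> I" using insert.hyps by auto
    then have "insert v C - I = insert v (C - I)" by auto
    moreover have "I \<subseteq> insert v C" using \<open>I \<subseteq> C\<close> by auto
    ultimately show "?a * ((\<Prod>i\<in>I. x i) * (\<Prod>i\<in>C - I. 1 - x i)) \<in> K"
      using insert.prems[of I] insert.hyps by (simp add: algebra_simps)
  qed
  have b: "?b \<in> K \<and> ?b * (\<Sum>i\<in>C. x i) \<in> K \<and> ?b * e2 C \<in> K \<and> ?b * (1 - (\<Sum>i\<in>C. x i) + e2 C) \<in> K"
  proof (rule insert.IH)
    fix I assume "I \<subseteq> C"
    then have "v \<notin> I" "finite I" using insert.hyps finite_subset by auto
    moreover have "insert v C - insert v I = C - I" using insert.hyps by auto
    moreover have "insert v I \<subseteq> insert v C" using \<open>I \<subseteq> C\<close> by auto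
    ultimately show "?b * ((\<Prod>i\<in>I. x i) * (\<Prod>i\<in>C - I. 1 - x i)) \<in> K"
      using insert.prems[of "insert v I"] by (simp add: mult.assoc)
  qed
  have e2: "e2 (insert v C) = e2 C + x v * (\<Sum>i\<in>C. x i)"
    unfolding e2_def using insert.hyps by (rule sum_pairs_insert)
  \<comment> \<open>Each of the four targets becomes a sum of members of \<open>K\<close> given by
    \<open>a\<close> and \<open>b\<close>. The conjuncts are carried together because the degree-2
    sum calls on the linear one, and the last target calls on the degree-2 sum.\<close>
  have "q = ?a + ?b"
    by (simp add: algebra_simps)
  moreover have "q * (\<Sum>i\<in>insert v C. x i) = (?a * (\<Sum>i\<in>C. x i) + ?b * (\<Sum>i\<in>C. x i)) + ?b"
    using insert.hyps by (simp add: algebra_simps)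
  moreover have "q * e2 (insert v C) = (?a * e2 C + ?b * e2 C) + ?b * (\<Sum>i\<in>C. x i)"
    by (simp add: e2 algebra_simps)
  moreover have "q * (1 - (\<Sum>i\<in>insert v C. x i) + e2 (insert v C))
      = ?a * (1 - (\<Sum>i\<in>C. x i) + e2 C) + ?b * e2 C"
    using insert.hyps by (simp add: e2 algebra_simps)
  ultimately show ?case using a b add by metis
qed

section \<open>The Handelman set as a convex cone\<close>

lemma pconst_0 [simp]: "pconst 0 = 0"
  and pconst_1 [simp]: "pconst 1 = 1"
  and pconst_add: "pconst (a + b) = pconst a + pconst b"
  and pconst_diff: "pconst (a - b) = pconst a - pconst b"
  and pconst_mult: "pconst (a * b) = pconst a * pconst b"
  by (simp_all add: pconst_def single_add single_diff mult_single)

lemma pconst_sum: "pconst (\<Sum>a\<in>A. f a) = (\<Sum>a\<in>A. pconst (f a))"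
  by (induction A rule: infinite_finite_induct) (auto simp: pconst_add)

lemma handelman_cone_0: "0 \<in> handelman_cone t n"
  unfolding handelman_cone_def by (auto intro!: exI[of _ "\<lambda>_ _. 0"])

lemma handelman_cone_add:
  assumes "p \<in> handelman_cone t n" "q \<in> handelman_cone t n"
  shows "p + q \<in> handelman_cone t n"
proof -
  let ?D = "\<lambda>T I. T \<subseteq> {1..n} \<and> card T \<le> t \<and> I \<subseteq> T"
  let ?S = "\<lambda>c. \<Sum>T | T \<subseteq> {1..n} \<and> card T \<le> t.
        \<Sum>I\<in>Pow T. pconst (c T I) * ((\<Prod>i\<in>I. pvar i) * (\<Prod>i\<in>T - I. 1 - pvar i))"
  obtain c d where "p = ?S c" "q = ?S d" "\<forall>T I. ?D T I \<longrightarrow> 0 \<le> c T I" "\<forall>T I. ?D T I \<longrightarrow> 0 \<le> d T I"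
    using assms unfolding handelman_cone_def by blast
  moreover from this have "p + q = ?S (\<lambda>T I. c T I + d T I)"
    by (simp add: pconst_add distrib_right sum.distrib)
  ultimately show ?thesis
    unfolding handelman_cone_def by (auto intro!: exI[of _ "\<lambda>T I. c T I + d T I"])
qed

lemma handelman_cone_scale:
  assumes "p \<in> handelman_cone t n" "0 \<le> a"
  shows "pconst a * p \<in> handelman_cone t n"
proof -
  let ?D = "\<lambda>T I. T \<subseteq> {1..n} \<and> card T \<le> t \<and> I \<subseteq> T"
  let ?S = "\<lambda>c. \<Sum>T | T \<subseteq> {1..n} \<and> card T \<le> t.
        \<Sum>I\<in>Pow T. pconst (c T I) * ((\<Prod>i\<in>I. pvar i) * (\<Prod>i\<in>T - I. 1 - pvar i))"
  obtain c where "p = ?S c" "\<forall>T I. ?D T I \<longrightarrow> 0 \<le> c T I"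
    using assms unfolding handelman_cone_def by blast
  moreover from this have "pconst a * p = ?S (\<lambda>T I. a * c T I)"
    by (simp add: pconst_mult sum_distrib_left mult.assoc)
  ultimately show ?thesis
    unfolding handelman_cone_def using assms(2) by (auto intro!: exI[of _ "\<lambda>T I. a * c T I"])
qed

lemma handelman_cone_sum:
  assumes "\<And>a. a \<in> A \<Longrightarrow> f a \<in> handelman_cone t n"
  shows "sum f A \<in> handelman_cone t n"
  using assms
  by (induction A rule: infinite_finite_induct) (auto intro: handelman_cone_0 handelman_cone_add)

lemma handelman_cone_generator:
  assumes "T \<subseteq> {1..n}" "card T \<le> t" "I \<subseteq> T"
  shows "(\<Prod>i\<in>I. pvar i) * (\<Prod>i\<in>T - I. 1 - pvar i) \<in> handelman_cone t n"
proof -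
  let ?b = "\<lambda>T I. (\<Prod>i\<in>I. pvar i) * (\<Prod>i\<in>T - I. 1 - pvar i)"
  \<comment> \<open>All coefficients vanish except a 1 at the pair \<open>(T, I)\<close>.\<close>
  let ?c = "\<lambda>T' I'. if T' = T then if I' = I then 1 else 0 else 0 :: real"
  have "finite T" using assms(1) finite_subset by blast
  have "(\<Sum>T' | T' \<subseteq> {1..n} \<and> card T' \<le> t. \<Sum>I'\<in>Pow T'. pconst (?c T' I') * ?b T' I')
      = (\<Sum>T' | T' \<subseteq> {1..n} \<and> card T' \<le> t.
          if T' = T then \<Sum>I'\<in>Pow T. if I' = I then ?b T I else 0 else 0)"
    by (intro sum.cong refl) (auto intro!: sum.neutral sum.cong)
  also have "\<dots> = ?b T I"
    using assms \<open>finite T\<close> by (simp add: sum.delta)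
  finally show ?thesis
    unfolding handelman_cone_def by (auto intro!: exI[of _ ?c])
qed

section \<open>Certificates from clique covers\<close>

lemma cover_weight_minus_graph_poly_in_handelman_cone:
  assumes "simple_graph n E" and "2 \<le> t"
    and u: "\<forall>i j. {i, j} \<in> E \<longrightarrow> min (w i) (w j) \<le> u {i, j}"
    and l: "l \<in> fractional_clique_covers t n E w"
  shows "pconst (sum l (cliques t n E)) - graph_poly n E w u \<in> handelman_cone t n"
proof -
  let ?K = "cliques t n E" and ?H = "handelman_cone t n"
  let ?X = "\<lambda>e. \<Prod>i\<in>e. pvar i"
  let ?e2 = "\<lambda>C. \<Sum>e | e \<subseteq> C \<and> card e = 2. ?X e"
  \<comment> \<open>\<open>s e\<close> is the total weight of the cliques containing
    \<open>e\<close>, hence the coefficient of the monomial of \<open>e\<close> in the sum of the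
    weighted clique polynomials.\<close>
  define s where "s e = (\<Sum>C\<in>?K. l C * of_bool (e \<subseteq> C))" for e
  have [simp]: "finite ?K"
    by (rule finite_subset[of _ "Pow {1..n}"]) (auto simp: cliques_def)
  have E: "e \<subseteq> {1..n}" "card e = 2" if "e \<in> E" for e
    using assms(1) that by (auto simp: simple_graph_def)
  have [simp]: "finite E"
    by (rule finite_subset[of _ "Pow {1..n}"]) (use E in auto)
  have l_nonneg: "0 \<le> l C" if "C \<in> ?K" for C
    using l that by (simp add: fractional_clique_covers_def)
  have w: "w i = (\<Sum>C\<in>?K. l C * of_bool (i \<in> C))" if "i \<in> {1..n}" for i
    using l that by (simp add: fractional_clique_covers_def indicator_def of_bool_def)
  have s_le_w: "s e \<le> w i" if "i \<in> e" "e \<in> E" for i e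
  proof -
    have "i \<in> {1..n}" using E that by blast
    then show ?thesis
      \<comment> \<open>A clique containing \<open>e\<close> contains its endpoint \<open>i\<close>,
        so the comparison is termwise.\<close>
      unfolding s_def w[OF \<open>i \<in> {1..n}\<close>] using that l_nonneg by (intro sum_mono) auto
  qed
  have s_le_u: "s e \<le> u e" if "e \<in> E" for e
  proof -
    have "card e = 2" using E that by blast
    then obtain i j where e: "e = {i, j}" by (auto simp: card_2_iff)
    then have "s e \<le> min (w i) (w j)" using s_le_w that by simp
    then show ?thesis using u that e by fastforce
  qed
  \<comment> \<open>All pairs inside a clique are edges, so exchanging the sums over edges and
    cliques yields the full degree-2 symmetric sum on each clique.\<close>
  have clique_edges: "{e \<in> E. e \<subseteq> C} = {e. e \<subseteq> C \<and> card e = 2}" if "C \<in> ?K" for C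
    using that E by (auto simp: cliques_def card_2_iff)
  have vertices: "(\<Sum>i\<in>{1..n}. pconst (w i) * pvar i) = (\<Sum>C\<in>?K. pconst (l C) * (\<Sum>i\<in>C. pvar i))"
  proof -
    have "(\<Sum>i\<in>{1..n}. pconst (w i) * pvar i)
        = (\<Sum>i\<in>{1..n}. \<Sum>C\<in>?K. if i \<in> C then pconst (l C) * pvar i else 0)"
      by (intro sum.cong refl, simp only: w pconst_sum sum_distrib_right, intro sum.cong refl) simp
    also have "\<dots> = (\<Sum>C\<in>?K. \<Sum>i\<in>{1..n}. if i \<in> C then pconst (l C) * pvar i else 0)"
      by (rule sum.swap)
    also have "\<dots> = (\<Sum>C\<in>?K. \<Sum>i\<in>{1..n} \<inter> C. pconst (l C) * pvar i)"
      by (simp add: sum.inter_restrict)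
    also have "\<dots> = (\<Sum>C\<in>?K. pconst (l C) * (\<Sum>i\<in>C. pvar i))"
      unfolding sum_distrib_left by (intro sum.cong refl) (auto simp: cliques_def)
    finally show ?thesis .
  qed
  have edges: "(\<Sum>e\<in>E. pconst (s e) * ?X e) = (\<Sum>C\<in>?K. pconst (l C) * ?e2 C)"
  proof -
    have "(\<Sum>e\<in>E. pconst (s e) * ?X e)
        = (\<Sum>e\<in>E. \<Sum>C\<in>?K. if e \<subseteq> C then pconst (l C) * ?X e else 0)"
      by (intro sum.cong refl, simp only: s_def pconst_sum sum_distrib_right, intro sum.cong refl) simp
    also have "\<dots> = (\<Sum>C\<in>?K. \<Sum>e\<in>E. if e \<subseteq> C then pconst (l C) * ?X e else 0)"
      by (rule sum.swap)
    also have "\<dots> = (\<Sum>C\<in>?K. \<Sum>e | e \<in> E \<and> e \<subseteq> C. pconst (l C) * ?X e)"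
      by (simp add: sum.inter_filter)
    also have "\<dots> = (\<Sum>C\<in>?K. pconst (l C) * ?e2 C)"
      unfolding sum_distrib_left by (intro sum.cong clique_edges refl)
    finally show ?thesis .
  qed
  have "pconst (sum l ?K) - graph_poly n E w u
      = (\<Sum>C\<in>?K. pconst (l C) * (1 - (\<Sum>i\<in>C. pvar i) + ?e2 C))
        + (\<Sum>e\<in>E. pconst (u e - s e) * ?X e)"
    unfolding graph_poly_def vertices
    by (simp add: edges pconst_sum pconst_diff ring_distribs sum_subtractf sum.distrib)
  moreover have "pconst (l C) * (1 - (\<Sum>i\<in>C. pvar i) + ?e2 C) \<in> ?H" if "C \<in> ?K" for C
  proof (rule handelman_cone_scale[OF _ l_nonneg[OF that]])
    have C: "C \<subseteq> {1..n}" "card C \<le> t" using that by (auto simp: cliques_def)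
    then have "finite C" using finite_subset by blast
    then show "1 - (\<Sum>i\<in>C. pvar i) + ?e2 C \<in> ?H"
      \<comment> \<open>With \<open>q = 1\<close>, the required products are the generators for
        \<open>T = C\<close>, admissible since \<open>card C \<le> t\<close>.\<close>
      using elementary_symmetric_in_cone[of C ?H 1 pvar] C
        handelman_cone_0 handelman_cone_add handelman_cone_generator by auto
  qed
  moreover have "pconst (u e - s e) * ?X e \<in> ?H" if "e \<in> E" for e
    \<comment> \<open>The edge monomial is the generator with \<open>T = I = e\<close>; it is
      available because \<open>card e = 2 \<le> t\<close>.\<close>
    using handelman_cone_generator[of e n t e] E[OF that] s_le_u[OF that] \<open>2 \<le> t\<close>
    by (intro handelman_cone_scale) auto
  ultimately show ?thesis
    by (metis (no_types, lifting) handelman_cone_add handelman_cone_sum)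
qed

section \<open>Existence of an optimal cover\<close>

text \<open>Covering each node \<open>i\<close> by its own singleton with weight \<open>w i\<close>
  is feasible; singletons have size at most \<open>t\<close> since \<open>1 \<le> t\<close>.\<close>

lemma fractional_clique_covers_nonempty:
  assumes "1 \<le> t" and "\<forall>i\<in>{1..n}. 0 \<le> w i"
  shows "fractional_clique_covers t n E w \<noteq> {}"
proof -
  let ?K = "cliques t n E"
  define l where "l C = (if is_singleton C then w (the_elem C) else 0)" for C
  have [simp]: "finite ?K"
    by (rule finite_subset[of _ "Pow {1..n}"]) (auto simp: cliques_def)
  have "0 \<le> l C" if "C \<in> ?K" for C
    using assms(2) that by (auto simp: l_def is_singleton_def cliques_def)
  moreover have "(\<Sum>C\<in>?K. l C * indicator C i) = w i" if "i \<in> {1..n}" for i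
  proof -
    have "(\<Sum>C\<in>?K. l C * indicator C i) = (\<Sum>C\<in>?K. if C = {i} then w i else 0)"
      by (intro sum.cong refl) (auto simp: l_def is_singleton_def indicator_def)
    also have "\<dots> = w i"
      using that assms(1) by (simp add: cliques_def)
    finally show ?thesis .
  qed
  ultimately have "l \<in> fractional_clique_covers t n E w"
    by (simp add: fractional_clique_covers_def)
  then show ?thesis by blast
qed

text \<open>\<open>LEAST\<close> on the reals denotes a minimum only if one exists; attainment
  therefore gives the defined number its intended meaning and supplies an optimal cover to build the
  certificate from.\<close>

lemma fractional_clique_cover_number_attained:
  assumes "1 \<le> t" and "\<forall>i\<in>{1..n}. 0 \<le> w i"
  obtains l where "l \<in> fractional_clique_covers t n E w"
    and "fractional_clique_cover_number t n E w = sum l (cliques t n E)"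
proof -
  let ?K = "cliques t n E" and ?S = "fractional_clique_covers t n E w"
  have "finite ?K"
    by (rule finite_subset[of _ "Pow {1..n}"]) (auto simp: cliques_def)
  then obtain l where l: "l \<in> ?S" "\<And>l'. l' \<in> ?S \<Longrightarrow> sum l ?K \<le> sum l' ?K"
    using nonneg_sum_attains_min[OF _ fractional_clique_covers_def
        fractional_clique_covers_nonempty[OF assms]] by blast
  then have "fractional_clique_cover_number t n E w = sum l ?K"
    unfolding fractional_clique_cover_number_def by (intro Least_equality) auto
  then show ?thesis using l(1) that by blast
qed

theorem proposition3:
  fixes n t :: nat and E :: "nat set set"
    and w :: "nat \<Rightarrow> real" and u :: "nat set \<Rightarrow> real"
  assumes "simple_graph n E"
    and "\<forall>i\<in>{1..n}. 0 \<le> w i"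
    and "\<forall>i j. {i, j} \<in> E \<longrightarrow> min (w i) (w j) \<le> u {i, j}"
    and "2 \<le> t"
  shows "pconst (fractional_clique_cover_number t n E w) - graph_poly n E w u
           \<in> handelman_cone t n \<and>
         handelman_bound t n E w u \<le> ereal (fractional_clique_cover_number t n E w)"
proof -
  have "1 \<le> t" using \<open>2 \<le> t\<close> by simp
  then obtain l where "l \<in> fractional_clique_covers t n E w"
    and "fractional_clique_cover_number t n E w = sum l (cliques t n E)"
    using fractional_clique_cover_number_attained assms(2) by metis
  then have "pconst (fractional_clique_cover_number t n E w) - graph_poly n E w u
      \<in> handelman_cone t n"
    using cover_weight_minus_graph_poly_in_handelman_cone assms(1,3,4) by simp
  \<comment> \<open>Membership in the cone makes the cover number one of the values over which the
    infimum is taken.\<close>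
  then show ?thesis
    unfolding handelman_bound_def by (auto intro: INF_lower)
qed

end
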